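(* Let $d>1$. Then $G^1_{\mathbb{R}^d}[C^d(l)]$ is connected if and only if $l\geq 2/\sqrt{d}$. Moreover, for $l=2/\sqrt{d}$, the graph diameter of $G^1_{\mathbb{R}^d}[C^d(l)]$ is at most $8$.
   Context: Here $d$ is an integer (the dimension). For $X\subseteq\mathbb{R}^d$, $G^1_{\mathbb{R}^d}[X]$ is the graph with vertex set $X$ in which $x,y\in X$ are joined by an edge exactly when their Euclidean distance is $1$. The graph distance between two vertices is the minimum number of edges in a path between them, and the graph diameter is the maximal graph distance between any pair of vertices. $C^d(l)=\{x\in\mathbb{R}^d: x_i\in[0,l]\text{ for all } i\}$ is the $d$-dimensional hypercube with side lengths $l$. *)

theory Defs
  imports "HOL-Analysis.Analysis" "HOL-Library.Extended_Nat" "Graph_Theory.Graph_Theory"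
begin

text \<open>
  An undirected graph is represented, as usual in the library \<open>Graph_Theory\<close>, by the
  bidirected digraph without parallel arcs that has both arcs \<open>(x, y)\<close> and \<open>(y, x)\<close> for
  every edge \<open>xy\<close>; the number of arcs of a path is then the number of its edges.
\<close>

definition unit_distance_graph ::
    "(real ^ 'n) set \<Rightarrow> (real ^ 'n, (real ^ 'n) \<times> (real ^ 'n)) pre_digraph" where
  "unit_distance_graph X =
     with_proj \<lparr> pverts = X, parcs = {(x, y). x \<in> X \<and> y \<in> X \<and> dist x y = 1} \<rparr>"

lemma pair_bidirected_unit_distance_graph:
  "pair_bidirected_digraph \<lparr> pverts = X, parcs = {(x, y). x \<in> X \<and> y \<in> X \<and> dist x y = 1} \<rparr>"
  for X :: "(real ^ 'n) set"
  by unfold_locales (auto simp: symmetric_def dist_commute intro!: symI)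

definition hypercube :: "real \<Rightarrow> (real ^ 'n) set" where
  "hypercube l = {x. \<forall>i. x $ i \<in> {0..l}}"

text \<open>
  Values are extended naturals: the distance is \<open>\<infinity>\<close> if there is no path, and the diameter
  is \<open>\<infinity>\<close> if the distances are unbounded. So a finite bound on the diameter in particular
  says that any two vertices are joined by a path. In \<open>apath u p v\<close>, the path is the list \<open>p\<close>
  of its arcs, and no vertex is repeated.
\<close>

definition graph_distance :: "('a, 'b) pre_digraph \<Rightarrow> 'a \<Rightarrow> 'a \<Rightarrow> enat" where
  "graph_distance G u v = (INF p \<in> {p. pre_digraph.apath G u p v}. enat (length p))"

definition graph_diameter :: "('a, 'b) pre_digraph \<Rightarrow> enat" where
  "graph_diameter G = (SUP u \<in> verts G. SUP v \<in> verts G. graph_distance G u v)"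

end

theory Submission
  imports Defs
begin

text \<open>
  Put $a = 1/\sqrt d$, so that the corners of a cube of side $2a$ are exactly the points of
  the cube adjacent to its centre. A point $x$ of the cube has distance at most $1$ from its
  nearest corner and at least $1$ from its farthest; walking between these two along edges of
  the cube, $x$ has a neighbour $y$ on some edge. Moving all coordinates of $y$ that are
  constant on the edge by the same amount, and the remaining one to the midpoint between $y$
  and an endpoint of the edge, gives a common neighbour of $y$ and that endpoint. So $x$ is at
  most four steps from the centre. In a larger cube, any two points close to each other in
  the maximum norm lie in a common subcube of side $2a$. In a smaller cube the centre is isolated.
\<close>

section \<open>Four unit steps from a point of a cube to its centre\<close>

lemma dist_vec_eq_1_iff: "dist x y = 1 \<longleftrightarrow> (\<Sum>i\<in>UNIV. (x $ i - y $ i)\<^sup>2) = 1"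
  for x y :: "real ^ 'n"
  by (simp add: dist_vec_def L2_set_def dist_real_def)

text \<open>Correcting the coordinates of the corner \<open>q\<close> in \<open>S\<close> one at a
  time leads to \<open>p\<close> along edges of the cube. The distance to \<open>x\<close> is
  continuous along this walk and passes from at least 1 to at most 1, so it equals 1 somewhere on
  it.\<close>

lemma unit_point_on_box_edge:
  fixes x p q :: "real ^ 'n"
  assumes "finite S" "\<And>i. \<bar>p $ i\<bar> = a" "\<And>i. \<bar>q $ i\<bar> = a" "\<And>i. i \<notin> S \<Longrightarrow> p $ i = q $ i"
    and "dist x p \<le> 1" "1 \<le> dist x q"
  shows "\<exists>y j. \<bar>y $ j\<bar> \<le> a \<and> (\<forall>i. i \<noteq> j \<longrightarrow> \<bar>y $ i\<bar> = a) \<and> dist x y = 1"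
  using assms
proof (induction S arbitrary: q)
  case empty
  then have "p = q" by (simp add: vec_eq_iff)
  with empty have "dist x p = 1" by simp
  with empty show ?case by (metis order_refl)
next
  case (insert k S)
  \<comment> \<open>The next corner on the way to \<open>p\<close>. If \<open>r\<close> is still at
    distance at least 1, the induction hypothesis applies to it; otherwise the value 1 is attained
    on the edge from \<open>r\<close> to \<open>q\<close>, which has direction
    \<open>k\<close>.\<close>
  define r where "r = (\<chi> i. if i = k then p $ k else q $ i)"
  show ?case
  proof (cases "1 \<le> dist x r")
    case True
    with insert show ?thesis by (intro insert.IH[of r]) (auto simp: r_def)
  next
    case False
    define f where "f = (\<lambda>t. (1 - t) *\<^sub>R r + t *\<^sub>R q)"
    have "\<exists>t. 0 \<le> t \<and> t \<le> 1 \<and> dist x (f t) = 1"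
      using False insert.prems(5)
      by (intro IVT') (auto simp: f_def intro!: continuous_intros)
    then obtain t where t: "0 \<le> t" "t \<le> 1" "dist x (f t) = 1" by blast
    have "\<bar>f t $ k\<bar> \<le> (1 - t) * \<bar>p $ k\<bar> + t * \<bar>q $ k\<bar>"
      using t by (simp add: f_def r_def abs_mult order_trans[OF abs_triangle_ineq])
    then have "\<bar>f t $ k\<bar> \<le> a" using insert.prems by (simp add: algebra_simps)
    moreover have "\<bar>f t $ i\<bar> = a" if "i \<noteq> k" for i
      using that insert.prems(2) by (simp add: f_def r_def algebra_simps)
    ultimately show ?thesis using t by blast
  qed
qed

lemma box_point_adjacent_to_edge:
  fixes x :: "real ^ 'n"
  assumes a: "a \<ge> 0" "real CARD('n) * a\<^sup>2 = 1" and x: "\<And>i. \<bar>x $ i\<bar> \<le> a"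
  obtains y j where "\<bar>y $ j\<bar> \<le> a" "\<And>i. i \<noteq> j \<Longrightarrow> \<bar>y $ i\<bar> = a" "dist x y = 1"
proof -
  \<comment> \<open>A corner nearest to \<open>x\<close>; \<open>- p\<close> is the opposite one. In
    each coordinate \<open>x\<close> differs from \<open>p\<close> by at most \<open>a\<close> and
    from \<open>- p\<close> by at least \<open>a\<close>, and the squares of \<open>a\<close> sum to
    1.\<close>
  define p where "p = (\<chi> i. if x $ i \<ge> 0 then a else - a)"
  have "(\<Sum>i\<in>UNIV. (x $ i - p $ i)\<^sup>2) \<le> (\<Sum>i\<in>(UNIV::'n set). a\<^sup>2)"
  proof (rule sum_mono)
    show "(x $ i - p $ i)\<^sup>2 \<le> a\<^sup>2" for i
      using x[of i] by (intro power2_le_iff_abs_le[THEN iffD2]) (auto simp: p_def a)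
  qed
  with a have 1: "dist x p \<le> 1" by (simp add: dist_vec_def L2_set_def dist_real_def)
  have "(\<Sum>i\<in>UNIV. (x $ i - (- p) $ i)\<^sup>2) \<ge> (\<Sum>i\<in>(UNIV::'n set). a\<^sup>2)"
  proof (rule sum_mono)
    show "a\<^sup>2 \<le> (x $ i - (- p) $ i)\<^sup>2" for i
      using a(1) by (intro abs_le_square_iff[THEN iffD1]) (auto simp: p_def)
  qed
  with a have 2: "1 \<le> dist x (- p)" by (simp add: dist_vec_def L2_set_def dist_real_def)
  have "\<exists>y j. \<bar>y $ j\<bar> \<le> a \<and> (\<forall>i. i \<noteq> j \<longrightarrow> \<bar>y $ i\<bar> = a) \<and> dist x y = 1"
    by (rule unit_point_on_box_edge[of UNIV p a "- p"]) (use 1 2 a(1) in \<open>auto simp: p_def\<close>)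
  with that show thesis by blast
qed

text \<open>Here \<open>y\<close> lies on an edge in direction \<open>j\<close> and \<open>w\<close>
  is the endpoint of that edge whose entry at \<open>j\<close> is \<open>a\<close>. Off
  \<open>j\<close> the two agree, so any \<open>z\<close> whose entry at \<open>j\<close> is their
  midpoint is equidistant from both; scaling the other entries adjusts this distance to 1.\<close>

lemma edge_point_to_corner:
  fixes y :: "real ^ 'n"
  assumes n: "CARD('n) > 1" and a: "a \<ge> 0" "real CARD('n) * a\<^sup>2 = 1"
    and y: "\<bar>y $ j\<bar> \<le> a" "\<And>i. i \<noteq> j \<Longrightarrow> \<bar>y $ i\<bar> = a"
  obtains z w where "\<And>i. \<bar>z $ i\<bar> \<le> a" "\<And>i. \<bar>w $ i\<bar> = a" "dist y z = 1" "dist z w = 1"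
proof -
  let ?n = "real CARD('n)"
  define d where "d = (a - y $ j) / 2"
  \<comment> \<open>The solution of \<open>d\<^sup>2 + (?n - 1) * a\<^sup>2 * s\<^sup>2 = 1\<close>,
    given \<open>?n * a\<^sup>2 = 1\<close>. Below, \<open>s\<close> is shown to be at most 2, so
    the factor \<open>1 - s\<close> does not take \<open>z\<close> out of the cube.\<close>
  define s where "s = sqrt (?n * (1 - d\<^sup>2) / (?n - 1))"
  define z where "z = (\<chi> i. if i = j then (y $ j + a) / 2 else y $ i * (1 - s))"
  define w where "w = (\<chi> i. if i = j then a else y $ i)"
  have "a\<^sup>2 * 1 \<le> a\<^sup>2 * ?n"
    using n by (intro mult_left_mono) auto
  then have "a\<^sup>2 \<le> 1" using a by (simp add: mult.commute)
  moreover have "d\<^sup>2 \<le> a\<^sup>2"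
    using y(1) by (intro abs_le_square_iff[THEN iffD1]) (auto simp: d_def)
  ultimately have d: "d\<^sup>2 \<le> 1" by simp
  have s2: "s\<^sup>2 = ?n * (1 - d\<^sup>2) / (?n - 1)"
    using d n by (simp add: s_def)
  have "s\<^sup>2 \<le> ?n / (?n - 1)"
    unfolding s2 using n by (intro divide_right_mono mult_left_le) auto
  also have "\<dots> \<le> 2\<^sup>2" using n by (simp add: divide_simps)
  finally have "s \<le> 2" by (rule power2_le_imp_le) simp
  moreover have "s \<ge> 0" using d n by (simp add: s_def)
  ultimately have s: "\<bar>1 - s\<bar> \<le> 1" by simp
  have sum: "(\<Sum>i\<in>(UNIV::'n set). if i = j then d\<^sup>2 else a\<^sup>2 * s\<^sup>2) = 1"
  proof -
    have "(\<Sum>i\<in>(UNIV::'n set). if i = j then d\<^sup>2 else a\<^sup>2 * s\<^sup>2)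
        = d\<^sup>2 + (\<Sum>i\<in>UNIV - {j}. if i = j then d\<^sup>2 else a\<^sup>2 * s\<^sup>2)"
      by (subst sum.remove[of UNIV j]) auto
    also have "(\<Sum>i\<in>UNIV - {j}. if i = j then d\<^sup>2 else a\<^sup>2 * s\<^sup>2) = (\<Sum>i\<in>UNIV - {j}. a\<^sup>2 * s\<^sup>2)"
      by (rule sum.cong) auto
    also have "\<dots> = (?n - 1) * (a\<^sup>2 * s\<^sup>2)"
      using n by (simp add: card_Diff_singleton of_nat_diff)
    also have "\<dots> = (?n * a\<^sup>2) * (1 - d\<^sup>2)"
      unfolding s2 using n by (simp add: field_simps)
    finally show ?thesis using a by simp
  qed
  have y2: "(y $ i)\<^sup>2 = a\<^sup>2" if "i \<noteq> j" for i
    using y(2)[OF that] by (metis power2_abs)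
  show thesis
  proof
    show "\<bar>z $ i\<bar> \<le> a" for i
      using y s mult_left_le[of "\<bar>1 - s\<bar>" a] a by (auto simp: z_def abs_mult)
    show "\<bar>w $ i\<bar> = a" for i using y a by (auto simp: w_def)
    have "(y $ i - z $ i)\<^sup>2 = (if i = j then d\<^sup>2 else a\<^sup>2 * s\<^sup>2)" for i
    proof (cases "i = j")
      case True
      have "y $ j - z $ j = - d" by (simp add: z_def d_def field_simps)
      with True show ?thesis by simp
    next
      case False
      then have "y $ i - z $ i = y $ i * s" by (simp add: z_def algebra_simps)
      with False show ?thesis by (simp add: y2 power_mult_distrib)
    qed
    with sum show "dist y z = 1" by (simp add: dist_vec_eq_1_iff)
    have "(z $ i - w $ i)\<^sup>2 = (if i = j then d\<^sup>2 else a\<^sup>2 * s\<^sup>2)" for i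
    proof (cases "i = j")
      case True
      have "z $ j - w $ j = - d" by (simp add: z_def w_def d_def field_simps)
      with True show ?thesis by simp
    next
      case False
      then have "z $ i - w $ i = - (y $ i * s)" by (simp add: z_def w_def algebra_simps)
      with False show ?thesis by (simp add: y2 power_mult_distrib)
    qed
    with sum show "dist z w = 1" by (simp add: dist_vec_eq_1_iff)
  qed
qed

text \<open>Translation by \<open>m\<close> reduces this to a cube centred at 0, whose corners have
  norm 1. The bounds on \<open>y\<close>, \<open>z\<close>, \<open>w\<close> keep the path available
  in every vertex set that contains the cube.\<close>

lemma box_path_to_centre:
  fixes x m :: "real ^ 'n"
  assumes n: "CARD('n) > 1" and a: "a \<ge> 0" "real CARD('n) * a\<^sup>2 = 1"
    and x: "\<And>i. \<bar>x $ i - m $ i\<bar> \<le> a"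
  obtains y z w where "\<And>i. \<bar>y $ i - m $ i\<bar> \<le> a" "\<And>i. \<bar>z $ i - m $ i\<bar> \<le> a"
    "\<And>i. \<bar>w $ i - m $ i\<bar> \<le> a" "dist x y = 1" "dist y z = 1" "dist z w = 1" "dist w m = 1"
proof -
  obtain y j where y: "\<bar>y $ j\<bar> \<le> a" "\<And>i. i \<noteq> j \<Longrightarrow> \<bar>y $ i\<bar> = a" "dist (x - m) y = 1"
    using box_point_adjacent_to_edge[OF a, of "x - m"] x by auto
  obtain z w where zw: "\<And>i. \<bar>z $ i\<bar> \<le> a" "\<And>i. \<bar>w $ i\<bar> = a" "dist y z = 1" "dist z w = 1"
    using edge_point_to_corner[OF n a y(1,2)] by blast
  have "(w $ i)\<^sup>2 = a\<^sup>2" for i using zw(2)[of i] by (metis power2_abs)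
  then have "dist w 0 = 1" unfolding dist_vec_eq_1_iff using a by simp
  moreover have "\<bar>y $ i\<bar> \<le> a" for i using y by (cases "i = j") auto
  ultimately show thesis
    using zw y(3) that[of "y + m" "z + m" "w + m"]
    by (simp add: dist_norm algebra_simps)
qed

section \<open>Graph distance and connectedness\<close>

context wf_digraph
begin

text \<open>Needed because \<open>graph_distance\<close> ranges over paths without repeated
  vertices: shortcutting a walk to such a path does not lengthen it.\<close>

lemma graph_distance_le_awalk:
  assumes "awalk u p v"
  shows "graph_distance G u v \<le> enat (length p)"
proof -
  let ?q = "awalk_to_apath p"
  have q: "apath u ?q v" by (rule apath_awalk_to_apath[OF assms])
  \<comment> \<open>The tails of the arcs are among the vertices of the path, which are
    distinct.\<close>
  then have "distinct ?q"
    by (auto simp: apath_def awalk_verts_conv distinct_map split: if_splits)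
  then have "length ?q = card (set ?q)" by (simp add: distinct_card)
  also have "\<dots> \<le> card (set p)" by (intro card_mono awalk_to_apath_subset[OF assms]) simp
  also have "\<dots> \<le> length p" by (rule card_length)
  finally have "length ?q \<le> length p" .
  moreover have "graph_distance G u v \<le> enat (length ?q)"
    unfolding graph_distance_def by (rule INF_lower) (use q in simp)
  ultimately show ?thesis by (meson enat_ord_simps(1) order_trans)
qed

text \<open>The library defines \<open>connected\<close> through the symmetric closure, which has
  the same reachability as a symmetric \<open>G\<close>.\<close>

lemma connected_iff_reachable:
  assumes "symmetric G"
  shows "connected G \<longleftrightarrow> verts G \<noteq> {} \<and> (\<forall>u\<in>verts G. \<forall>v\<in>verts G. u \<rightarrow>\<^sup>* v)"
  using reachable_mk_symmetric_eq[OF assms]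
  by (auto simp: connected_def strongly_connected_def)

end

lemma unit_distance_graph_simps:
  "verts (unit_distance_graph X) = X"
  "arcs (unit_distance_graph X) = {(x, y). x \<in> X \<and> y \<in> X \<and> dist x y = 1}"
  "arcs_ends (unit_distance_graph X) = {(x, y). x \<in> X \<and> y \<in> X \<and> dist x y = 1}"
  "tail (unit_distance_graph X) = fst" "head (unit_distance_graph X) = snd"
  by (simp_all add: unit_distance_graph_def)

lemma wf_unit_distance_graph: "wf_digraph (unit_distance_graph X)"
  by unfold_locales (auto simp: unit_distance_graph_simps)

lemma symmetric_unit_distance_graph: "symmetric (unit_distance_graph X)"
  by (auto simp: symmetric_def unit_distance_graph_simps dist_commute intro!: symI)

section \<open>Walks in cubes of side at least the critical one\<close>

lemma box_awalk:
  fixes x x' m :: "real ^ 'n"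
  assumes n: "CARD('n) > 1" and a: "a \<ge> 0" "real CARD('n) * a\<^sup>2 = 1"
    and X: "\<And>u. (\<And>i. \<bar>u $ i - m $ i\<bar> \<le> a) \<Longrightarrow> u \<in> X"
    and x: "\<And>i. \<bar>x $ i - m $ i\<bar> \<le> a" "\<And>i. \<bar>x' $ i - m $ i\<bar> \<le> a"
  obtains p where "pre_digraph.awalk (unit_distance_graph X) x p x'" "length p = 8"
proof -
  interpret wf_digraph "unit_distance_graph X" by (rule wf_unit_distance_graph)
  obtain y z w where 1: "\<And>i. \<bar>y $ i - m $ i\<bar> \<le> a" "\<And>i. \<bar>z $ i - m $ i\<bar> \<le> a"
    "\<And>i. \<bar>w $ i - m $ i\<bar> \<le> a" "dist x y = 1" "dist y z = 1" "dist z w = 1" "dist w m = 1"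
    using box_path_to_centre[OF n a x(1)] by blast
  obtain y' z' w' where 2: "\<And>i. \<bar>y' $ i - m $ i\<bar> \<le> a" "\<And>i. \<bar>z' $ i - m $ i\<bar> \<le> a"
    "\<And>i. \<bar>w' $ i - m $ i\<bar> \<le> a" "dist x' y' = 1" "dist y' z' = 1" "dist z' w' = 1" "dist w' m = 1"
    using box_path_to_centre[OF n a x(2)] by blast
  have "m \<in> X" "x \<in> X" "y \<in> X" "z \<in> X" "w \<in> X" "x' \<in> X" "y' \<in> X" "z' \<in> X" "w' \<in> X"
    using a(1) x 1 2 by (auto intro!: X)
  \<comment> \<open>The path from \<open>x'\<close> to the centre is traversed backwards.\<close>
  then have "awalk x [(x, y), (y, z), (z, w), (w, m), (m, w'), (w', z'), (z', y'), (y', x')] x'"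
    using 1 2 by (simp add: awalk_simps unit_distance_graph_simps dist_commute)
  then show thesis by (rule that) simp
qed

lemma hypercube_nearby_awalk:
  fixes x y :: "real ^ 'n"
  assumes n: "CARD('n) > 1" and l: "l \<ge> 2 / sqrt (real CARD('n))"
    and xy: "x \<in> hypercube l" "y \<in> hypercube l"
    and close: "\<And>i. \<bar>x $ i - y $ i\<bar> \<le> 2 / sqrt (real CARD('n))"
  obtains p where "pre_digraph.awalk (unit_distance_graph (hypercube l)) x p y" "length p = 8"
proof -
  define a where "a = 1 / sqrt (real CARD('n))"
  have a: "a \<ge> 0" "real CARD('n) * a\<^sup>2 = 1" and l': "l \<ge> 2 * a"
    using n l by (auto simp: a_def power_divide)
  have close': "\<bar>x $ i - y $ i\<bar> \<le> 2 * a" for i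
    using close[of i] by (simp add: a_def)
  \<comment> \<open>Centre of a subcube of side \<open>2 * a\<close>: in each coordinate its
    interval starts at the smaller of the two entries, or is pushed back to end at \<open>l\<close>
    if it would leave the large cube.\<close>
  define m :: "real ^ 'n" where "m = (\<chi> i. a + min (min (x $ i) (y $ i)) (l - 2 * a))"
  have x: "0 \<le> x $ i" "x $ i \<le> l" and y: "0 \<le> y $ i" "y $ i \<le> l" for i
    using xy by (auto simp: hypercube_def)
  have m: "a \<le> m $ i" "m $ i \<le> l - a" "\<bar>x $ i - m $ i\<bar> \<le> a" "\<bar>y $ i - m $ i\<bar> \<le> a" for i
    using x[of i] y[of i] l' close'[of i] a(1)
    unfolding m_def vec_lambda_beta by linarith+
  have "u \<in> hypercube l" if "\<And>i. \<bar>u $ i - m $ i\<bar> \<le> a" for u :: "real ^ 'n"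
    unfolding hypercube_def
  proof safe
    show "u $ i \<in> {0..l}" for i
      using that[of i] m(1,2)[of i] by auto
  qed
  then show thesis
    using box_awalk[OF n a, of m "hypercube l" x y] m that by blast
qed

text \<open>By convexity the segment from \<open>x\<close> to \<open>y\<close> stays in the cube. It
  is cut into \<open>N\<close> equal pieces so short that \<open>hypercube_nearby_awalk\<close>
  joins consecutive points.\<close>

lemma hypercube_reachable:
  fixes x y :: "real ^ 'n"
  assumes n: "CARD('n) > 1" and l: "l \<ge> 2 / sqrt (real CARD('n))"
    and xy: "x \<in> hypercube l" "y \<in> hypercube l"
  shows "x \<rightarrow>\<^sup>*\<^bsub>unit_distance_graph (hypercube l)\<^esub> y"
proof -
  let ?G = "unit_distance_graph (hypercube l :: (real ^ 'n) set)"
  interpret wf_digraph ?G by (rule wf_unit_distance_graph)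
  define h where "h = 2 / sqrt (real CARD('n))"
  have h: "h > 0" by (simp add: h_def)
  obtain N where "l / h < real N" using reals_Archimedean2 by blast
  moreover have "l > 0" using h l unfolding h_def[symmetric] by linarith
  then have "l / h > 0" using h by simp
  ultimately have "N > 0" "l < h * real N" using h
    by (auto simp: field_simps intro!: Nat.gr0I)
  then have N: "N > 0" "l / real N \<le> h" by (simp_all add: pos_divide_le_eq)
  define f where "f = (\<lambda>k::nat. x + (real k / real N) *\<^sub>R (y - x))"
  have x: "0 \<le> x $ i" "x $ i \<le> l" and y: "0 \<le> y $ i" "y $ i \<le> l" for i
    using xy by (auto simp: hypercube_def)
  have f: "f k \<in> hypercube l" if "k \<le> N" for k
  proof -
    have "convex {0..l}" by simp
    have "f k $ i \<in> {0..l}" for i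
    proof -
      have "f k $ i = (1 - real k / real N) *\<^sub>R x $ i + (real k / real N) *\<^sub>R y $ i"
        by (simp add: f_def algebra_simps)
      also have "\<dots> \<in> {0..l}"
        using x y that N by (intro convexD[OF \<open>convex {0..l}\<close>]) auto
      finally show ?thesis .
    qed
    then show ?thesis by (simp add: hypercube_def)
  qed
  have "x \<rightarrow>\<^sup>*\<^bsub>?G\<^esub> f k" if "k \<le> N" for k
    using that
  proof (induction k)
    case 0
    then show ?case using xy by (simp add: f_def unit_distance_graph_simps)
  next
    case (Suc k)
    have "\<bar>f k $ i - f (Suc k) $ i\<bar> \<le> h" for i
    proof -
      have "f k $ i - f (Suc k) $ i = (x $ i - y $ i) / real N"
        by (simp add: f_def field_simps add_divide_distrib diff_divide_distrib)
      also have "\<bar>\<dots>\<bar> \<le> l / real N"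
        using x[of i] y[of i] by (simp add: abs_divide divide_right_mono)
      finally show ?thesis using N by simp
    qed
    moreover have "f k \<in> hypercube l" "f (Suc k) \<in> hypercube l"
      using f Suc.prems by simp_all
    ultimately obtain p where "awalk (f k) p (f (Suc k))"
      unfolding h_def using hypercube_nearby_awalk[OF n l] by blast
    then have "f k \<rightarrow>\<^sup>*\<^bsub>?G\<^esub> f (Suc k)" by (rule reachable_awalkI)
    with Suc show ?case using reachable_trans by auto
  qed
  from this[of N] show ?thesis using N by (simp add: f_def)
qed

section \<open>Smaller cubes, and the theorem\<close>

lemma hypercube_not_connected:
  assumes "l > 0" and l: "l < 2 / sqrt (real CARD('n))"
  shows "\<not> Digraph_Component.connected (unit_distance_graph (hypercube l :: (real ^ 'n) set))"
proof
  let ?X = "hypercube l :: (real ^ 'n) set"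
  interpret wf_digraph "unit_distance_graph ?X" by (rule wf_unit_distance_graph)
  \<comment> \<open>The centre: all points of the cube are within
    \<open>l / 2 * sqrt (real CARD('n))\<close> of it, which is less than 1. Since
    \<open>l > 0\<close>, the corner 0 is a different vertex.\<close>
  define c :: "real ^ 'n" where "c = (\<chi> i. l / 2)"
  have c: "c \<in> ?X" "0 \<in> ?X" "c \<noteq> 0" using \<open>l > 0\<close> by (auto simp: hypercube_def c_def vec_eq_iff)
  have isolated: "dist c u \<noteq> 1" if "u \<in> ?X" for u
  proof -
    have "(\<Sum>i\<in>UNIV. (c $ i - u $ i)\<^sup>2) \<le> (\<Sum>i\<in>(UNIV::'n set). (l / 2)\<^sup>2)"
    proof (rule sum_mono)
      fix i
      have "0 \<le> u $ i" "u $ i \<le> l" using that by (auto simp: hypercube_def)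
      then show "(c $ i - u $ i)\<^sup>2 \<le> (l / 2)\<^sup>2"
        by (intro abs_le_square_iff[THEN iffD1]) (auto simp: c_def abs_if field_simps)
    qed
    also have "\<dots> = (l / 2 * sqrt (real CARD('n)))\<^sup>2" unfolding power_mult_distrib by simp
    also have "\<dots> < 1"
      using l \<open>l > 0\<close> by (intro power_less_one_iff[THEN iffD2]) (auto simp: field_simps)
    finally show ?thesis by (simp add: dist_vec_eq_1_iff)
  qed
  assume "connected (unit_distance_graph ?X)"
  then have "c \<rightarrow>\<^sup>*\<^bsub>unit_distance_graph ?X\<^esub> 0"
    using c by (simp add: connected_iff_reachable symmetric_unit_distance_graph unit_distance_graph_simps)
  then obtain p where "awalk c p 0" by (auto simp: reachable_awalk)
  with c isolated show False
    \<comment> \<open>The walk is nonempty because \<open>c\<close> is not 0, and its first arc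
      would be an edge at \<open>c\<close>.\<close>
    by (cases p) (auto simp: awalk_simps unit_distance_graph_simps)
qed

theorem proposition5p1:
  fixes l :: real
  assumes "CARD('n::finite) > 1" and "l > 0"
  shows "(Digraph_Component.connected (unit_distance_graph (hypercube l :: (real ^ 'n) set))
            \<longleftrightarrow> l \<ge> 2 / sqrt (real CARD('n)))
       \<and> (l = 2 / sqrt (real CARD('n)) \<longrightarrow>
            graph_diameter (unit_distance_graph (hypercube l :: (real ^ 'n) set)) \<le> 8)"
proof (intro conjI impI iffI)
  let ?X = "hypercube l :: (real ^ 'n) set"
  interpret wf_digraph "unit_distance_graph ?X" by (rule wf_unit_distance_graph)
  show "l \<ge> 2 / sqrt (real CARD('n))" if "connected (unit_distance_graph ?X)"
    using that hypercube_not_connected[OF assms(2), where ?'n = 'n] by (meson not_le)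
  show "connected (unit_distance_graph ?X)" if "l \<ge> 2 / sqrt (real CARD('n))"
  proof -
    have "0 \<in> ?X" using assms(2) by (simp add: hypercube_def)
    then show ?thesis
      using hypercube_reachable[OF assms(1) that]
      by (auto simp: connected_iff_reachable symmetric_unit_distance_graph unit_distance_graph_simps)
  qed
  show "graph_diameter (unit_distance_graph ?X) \<le> 8" if l: "l = 2 / sqrt (real CARD('n))"
    unfolding graph_diameter_def unit_distance_graph_simps
  proof (intro SUP_least)
    fix x y assume xy: "x \<in> ?X" "y \<in> ?X"
    \<comment> \<open>At the critical side every pair of points is close enough for a single walk of
      eight steps.\<close>
    have "\<bar>x $ i - y $ i\<bar> \<le> 2 / sqrt (real CARD('n))" for i
    proof -
      have "x $ i \<in> {0..l}" "y $ i \<in> {0..l}" using xy by (auto simp: hypercube_def)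
      then show ?thesis unfolding l[symmetric] by auto
    qed
    then obtain p where "awalk x p y" "length p = 8"
      using hypercube_nearby_awalk[OF assms(1) eq_refl[OF l[symmetric]] xy] by blast
    then have "graph_distance (unit_distance_graph ?X) x y \<le> enat 8"
      using graph_distance_le_awalk by metis
    then show "graph_distance (unit_distance_graph ?X) x y \<le> 8"
      by (simp add: numeral_eq_enat)
  qed
qed

end
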